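(* Let $U_1=\{L(\alpha)\in CE(\mu_8): b_{1,6}\neq0,\ b_{1,1}\neq0\}$, and for $\alpha=(b_{0,0},b_{0,1},b_{1,1},b_{1,2},b_{1,4},b_{1,6})$ put $\Delta=b_{0,1}^2-4b_{0,0}b_{1,1}$ (and $\Delta'=b_{0,1}'^2-4b_{0,0}'b_{1,1}'$ for $\alpha'$). (1) Two algebras $L(\alpha)$ and $L(\alpha')$ from $U_1$ are isomorphic if and only if $$\left(\frac{b_{1,6}}{b_{1,1}}\right)^{12}\Delta^5=\left(\frac{b_{1,6}'}{b_{1,1}'}\right)^{12}\Delta'^5.$$ (2) For any $\lambda\in\mathbb{C}$ there exists $L(\alpha)\in U_1$ with $\left(\frac{b_{1,6}}{b_{1,1}}\right)^{12}\Delta^5=\lambda$. Then the algebras from $U_1$ can be parameterized as $L(\lambda,0,1,0,0,1)$, $\lambda\in\mathbb{C}$; that is, every algebra in $U_1$ is isomorphic to $L(\lambda,0,1,0,0,1)$ for some $\lambda\in\mathbb{C}$.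
   Context: A Leibniz algebra over $\mathbb{C}$ is a complex vector space with a bilinear bracket satisfying $[x,[y,z]]=[[x,y],z]-[[x,z],y]$. $CE(\mu_8)$ (one-dimensional Leibniz central extensions of the 8-dimensional naturally graded filiform Lie algebra $\mu_8$) is the class of the 9-dimensional complex Leibniz algebras $L(\alpha)$, $\alpha=(b_{0,0},b_{0,1},b_{1,1},b_{1,2},b_{1,4},b_{1,6})\in\mathbb{C}^6$, with basis $e_0,\dots,e_8$ and brackets $[e_i,e_0]=e_{i+1}$ ($1\le i\le 7$), $[e_0,e_i]=-e_{i+1}$ ($2\le i\le 7$), $[e_0,e_0]=b_{0,0}e_8$, $[e_0,e_1]=-e_2+b_{0,1}e_8$, $[e_1,e_1]=b_{1,1}e_8$, $[e_1,e_2]=-[e_2,e_1]=b_{1,2}e_8$, $[e_1,e_4]=-[e_4,e_1]=b_{1,4}e_8$, $[e_2,e_3]=-[e_3,e_2]=-b_{1,4}e_8$, $[e_1,e_6]=-[e_6,e_1]=b_{1,6}e_8$, $[e_2,e_5]=-[e_5,e_2]=-b_{1,6}e_8$, $[e_3,e_4]=-[e_4,e_3]=b_{1,6}e_8$, all other brackets of basis vectors being zero. Isomorphic means isomorphic as Leibniz algebras. *)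

theory Defs
  imports "HOL-Analysis.Analysis"
begin

section \<open>Leibniz algebras over the complex numbers\<close>

text \<open>The Leibniz identity is the one for which right multiplications are derivations.\<close>

locale leibniz_algebra = vector_space scale
  for scale :: "complex \<Rightarrow> 'a::ab_group_add \<Rightarrow> 'a" +
  fixes bracket :: "'a \<Rightarrow> 'a \<Rightarrow> 'a"
  assumes bracket_linear_left: "Vector_Spaces.linear scale scale (\<lambda>x. bracket x y)"
    and bracket_linear_right: "Vector_Spaces.linear scale scale (\<lambda>y. bracket x y)"
    and leibniz: "bracket x (bracket y z) = bracket (bracket x y) z - bracket (bracket x z) y"

definition leibniz_iso ::
    "(complex \<Rightarrow> 'a::ab_group_add \<Rightarrow> 'a) \<Rightarrow> ('a \<Rightarrow> 'a \<Rightarrow> 'a) \<Rightarrow>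
     (complex \<Rightarrow> 'b::ab_group_add \<Rightarrow> 'b) \<Rightarrow> ('b \<Rightarrow> 'b \<Rightarrow> 'b) \<Rightarrow> ('a \<Rightarrow> 'b) \<Rightarrow> bool" where
  "leibniz_iso s1 br1 s2 br2 f \<longleftrightarrow>
     Vector_Spaces.linear s1 s2 f \<and> bij f \<and> (\<forall>x y. f (br1 x y) = br2 (f x) (f y))"

definition leibniz_isomorphic ::
    "(complex \<Rightarrow> 'a::ab_group_add \<Rightarrow> 'a) \<Rightarrow> ('a \<Rightarrow> 'a \<Rightarrow> 'a) \<Rightarrow>
     (complex \<Rightarrow> 'b::ab_group_add \<Rightarrow> 'b) \<Rightarrow> ('b \<Rightarrow> 'b \<Rightarrow> 'b) \<Rightarrow> bool" where
  "leibniz_isomorphic s1 br1 s2 br2 \<longleftrightarrow> (\<exists>f. leibniz_iso s1 br1 s2 br2 f)"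


section \<open>The class of one-dimensional central extensions of \<open>\<mu>\<^sub>8\<close>\<close>

text \<open>The underlying space of every algebra is \<^typ>\<open>complex ^ 9\<close>. The index type \<^typ>\<open>9\<close> is
  the integers modulo 9, so \<open>e 0, \<dots>, e 8\<close> is the standard basis, and \<open>e i\<close> is only
  meant for \<open>i \<le> 8\<close>.\<close>

definition e :: "nat \<Rightarrow> complex ^ 9" where
  "e i = axis (of_nat i) 1"

datatype params =
  Params (b00: complex) (b01: complex) (b11: complex) (b12: complex) (b14: complex) (b16: complex)

definition basis_bracket :: "params \<Rightarrow> nat \<Rightarrow> nat \<Rightarrow> complex ^ 9" where
  "basis_bracket \<alpha> i j =
    (if 1 \<le> i \<and> i \<le> 7 \<and> j = 0 then e (i + 1)
     else if i = 0 \<and> 2 \<le> j \<and> j \<le> 7 then - e (j + 1)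
     else if i = 0 \<and> j = 0 then b00 \<alpha> *s e 8
     else if i = 0 \<and> j = 1 then - e 2 + b01 \<alpha> *s e 8
     else if i = 1 \<and> j = 1 then b11 \<alpha> *s e 8
     else if i = 1 \<and> j = 2 then b12 \<alpha> *s e 8
     else if i = 2 \<and> j = 1 then - (b12 \<alpha> *s e 8)
     else if i = 1 \<and> j = 4 then b14 \<alpha> *s e 8
     else if i = 4 \<and> j = 1 then - (b14 \<alpha> *s e 8)
     else if i = 2 \<and> j = 3 then - (b14 \<alpha> *s e 8)
     else if i = 3 \<and> j = 2 then b14 \<alpha> *s e 8
     else if i = 1 \<and> j = 6 then b16 \<alpha> *s e 8
     else if i = 6 \<and> j = 1 then - (b16 \<alpha> *s e 8)
     else if i = 2 \<and> j = 5 then - (b16 \<alpha> *s e 8)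
     else if i = 5 \<and> j = 2 then b16 \<alpha> *s e 8
     else if i = 3 \<and> j = 4 then b16 \<alpha> *s e 8
     else if i = 4 \<and> j = 3 then - (b16 \<alpha> *s e 8)
     else 0)"

text \<open>An algebra is identified with its bracket; \<open>L \<alpha>\<close> is the bilinear extension of
  \<^const>\<open>basis_bracket\<close>.\<close>

definition L :: "params \<Rightarrow> complex ^ 9 \<Rightarrow> complex ^ 9 \<Rightarrow> complex ^ 9" where
  "L \<alpha> x y = (\<Sum>i\<le>8. \<Sum>j\<le>8. (x $ of_nat i * y $ of_nat j) *s basis_bracket \<alpha> i j)"

definition CE_mu8 :: "(complex ^ 9 \<Rightarrow> complex ^ 9 \<Rightarrow> complex ^ 9) set" where
  "CE_mu8 = range L"

definition U1 :: "(complex ^ 9 \<Rightarrow> complex ^ 9 \<Rightarrow> complex ^ 9) set" where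
  "U1 = {L \<alpha> |\<alpha>. L \<alpha> \<in> CE_mu8 \<and> b16 \<alpha> \<noteq> 0 \<and> b11 \<alpha> \<noteq> 0}"

definition Delta :: "params \<Rightarrow> complex" where
  "Delta \<alpha> = (b01 \<alpha>)\<^sup>2 - 4 * b00 \<alpha> * b11 \<alpha>"

abbreviation isomorphic ::
    "(complex ^ 9 \<Rightarrow> complex ^ 9 \<Rightarrow> complex ^ 9) \<Rightarrow> (complex ^ 9 \<Rightarrow> complex ^ 9 \<Rightarrow> complex ^ 9) \<Rightarrow> bool"
    (infix "\<simeq>" 50) where
  "A \<simeq> B \<equiv> leibniz_isomorphic (*s) A (*s) B"


section \<open>Well-definedness\<close>

lemma exhaust_9: "i \<in> {0, 1, 2, 3, 4, 5, 6, 7, 8}" for i :: 9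
proof -
  obtain z where z: "i = of_int z" "0 \<le> z" "z < int CARD(9)"
    by (rule bit1_cases)
  then have "z \<in> {0, 1, 2, 3, 4, 5, 6, 7, 8}"
    by auto
  with z(1) show ?thesis by auto
qed

lemma of_nat_eq_9: "(of_nat i :: 9) = of_nat j \<longleftrightarrow> i = j" if "i \<le> 8" "j \<le> 8"
proof -
  have "i \<in> {0, 1, 2, 3, 4, 5, 6, 7, 8}" "j \<in> {0, 1, 2, 3, 4, 5, 6, 7, 8}"
    using that by auto
  then show ?thesis by auto
qed

lemma L_basis: "L \<alpha> (e i) (e j) = basis_bracket \<alpha> i j" if "i \<le> 8" "j \<le> 8"
proof -
  have "L \<alpha> (e i) (e j) =
      (\<Sum>k\<le>8. \<Sum>l\<le>8. if k = i then if l = j then basis_bracket \<alpha> k l else 0 else 0)"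
    unfolding L_def e_def using that
    by (intro sum.cong refl) (auto simp: axis_def of_nat_eq_9)
  also have "\<dots> = (\<Sum>k\<le>8. if k = i then \<Sum>l\<le>8. if l = j then basis_bracket \<alpha> k l else 0 else 0)"
    by (intro sum.cong refl) auto
  also have "\<dots> = basis_bracket \<alpha> i j"
    using that by simp
  finally show ?thesis .
qed

lemma L_nth:
  "L \<alpha> x y $ 0 = 0" "L \<alpha> x y $ 1 = 0"
  "L \<alpha> x y $ 2 = x $ 1 * y $ 0 - x $ 0 * y $ 1"
  "L \<alpha> x y $ 3 = x $ 2 * y $ 0 - x $ 0 * y $ 2"
  "L \<alpha> x y $ 4 = x $ 3 * y $ 0 - x $ 0 * y $ 3"
  "L \<alpha> x y $ 5 = x $ 4 * y $ 0 - x $ 0 * y $ 4"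
  "L \<alpha> x y $ 6 = x $ 5 * y $ 0 - x $ 0 * y $ 5"
  "L \<alpha> x y $ 7 = x $ 6 * y $ 0 - x $ 0 * y $ 6"
  "L \<alpha> x y $ 8 = x $ 7 * y $ 0 - x $ 0 * y $ 7
     + b00 \<alpha> * (x $ 0 * y $ 0) + b01 \<alpha> * (x $ 0 * y $ 1) + b11 \<alpha> * (x $ 1 * y $ 1)
     + b12 \<alpha> * (x $ 1 * y $ 2 - x $ 2 * y $ 1)
     + b14 \<alpha> * (x $ 1 * y $ 4 - x $ 4 * y $ 1 - x $ 2 * y $ 3 + x $ 3 * y $ 2)
     + b16 \<alpha> * (x $ 1 * y $ 6 - x $ 6 * y $ 1 - x $ 2 * y $ 5 + x $ 5 * y $ 2
                + x $ 3 * y $ 4 - x $ 4 * y $ 3)"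
  by (simp_all add: L_def basis_bracket_def e_def axis_def atMost_nat_numeral)
     (simp_all add: algebra_simps)

lemma vec9_eqI:
  fixes x y :: "complex ^ 9"
  assumes "x $ 0 = y $ 0" "x $ 1 = y $ 1" "x $ 2 = y $ 2" "x $ 3 = y $ 3" "x $ 4 = y $ 4"
    "x $ 5 = y $ 5" "x $ 6 = y $ 6" "x $ 7 = y $ 7" "x $ 8 = y $ 8"
  shows "x = y"
  unfolding vec_eq_iff
proof
  fix i
  show "x $ i = y $ i" using exhaust_9[of i] assms by auto
qed

lemma leibniz_algebra_L: "leibniz_algebra (*s) (L \<alpha>)"
proof
  fix x y z :: "complex ^ 9" and c :: complex
  show "L \<alpha> (x + y) z = L \<alpha> x z + L \<alpha> y z" "L \<alpha> x (y + z) = L \<alpha> x y + L \<alpha> x z"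
    "L \<alpha> (c *s x) y = c *s L \<alpha> x y" "L \<alpha> x (c *s y) = c *s L \<alpha> x y"
    "L \<alpha> x (L \<alpha> y z) = L \<alpha> (L \<alpha> x y) z - L \<alpha> (L \<alpha> x z) y"
    by (rule vec9_eqI; simp add: L_nth algebra_simps)+
qed

lemma inj_L: "inj L"
proof (rule injI)
  fix \<alpha> \<beta> assume "L \<alpha> = L \<beta>"
  then have "basis_bracket \<alpha> i j $ 8 = basis_bracket \<beta> i j $ 8" if "i \<le> 8" "j \<le> 8" for i j
    using L_basis[OF that, of \<alpha>] L_basis[OF that, of \<beta>] by simp
  from this[of 0 0] this[of 0 1] this[of 1 1] this[of 1 2] this[of 1 4] this[of 1 6]
  show "\<alpha> = \<beta>"
    by (cases \<alpha>; cases \<beta>) (simp add: basis_bracket_def e_def axis_def)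
qed

lemma L_in_U1_iff: "L \<alpha> \<in> U1 \<longleftrightarrow> b16 \<alpha> \<noteq> 0 \<and> b11 \<alpha> \<noteq> 0"
  unfolding U1_def CE_mu8_def using inj_L by (auto dest: injD)

end

theory Submission
  imports Defs
begin

text \<open>An isomorphism \<open>f : L \<alpha> \<rightarrow> L \<alpha>'\<close> is determined by \<open>f e\<^sub>0 = p e\<^sub>0 + q e\<^sub>1 + \<dots>\<close> and
  \<open>f e\<^sub>1 = r e\<^sub>1 + \<dots>\<close>, where the coefficient of \<open>e\<^sub>0\<close> in \<open>f e\<^sub>1\<close> vanishes because \<open>[e\<^sub>6, e\<^sub>1]\<close> is
  central, and \<open>f e\<^sub>8 = p\<^sup>7 r e\<^sub>8\<close>. Comparing \<open>[e\<^sub>6, e\<^sub>1]\<close> and \<open>[e\<^sub>1, e\<^sub>1]\<close> gives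
  \<open>b\<^sub>1\<^sub>6' r = p\<^sup>2 b\<^sub>1\<^sub>6\<close> and \<open>b\<^sub>1\<^sub>1' r = p\<^sup>7 b\<^sub>1\<^sub>1\<close>, and the discriminant of the quadratic form
  \<open>x \<mapsto> [x, x]\<close> on \<open>\<langle>e\<^sub>0, e\<^sub>1\<rangle>\<close> gives \<open>\<Delta>' = p\<^sup>1\<^sup>2 \<Delta>\<close>; hence the invariant. Conversely, equality of
  the invariants provides such a \<open>p\<close>, the coefficient \<open>q\<close> then adjusts \<open>b\<^sub>0\<^sub>1\<close>, and the
  coefficients of \<open>e\<^sub>3\<close> and \<open>e\<^sub>5\<close> in \<open>f e\<^sub>1\<close> adjust \<open>b\<^sub>1\<^sub>4\<close> and \<open>b\<^sub>1\<^sub>2\<close>.\<close>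

section \<open>Scaling relations forced by an isomorphism\<close>

lemma isomorphic_imp_scaling:
  assumes "L \<alpha> \<simeq> L \<alpha>'" and b16: "b16 \<alpha> \<noteq> 0"
  obtains p r where "p \<noteq> 0" "r \<noteq> 0" "b16 \<alpha>' * r = p^2 * b16 \<alpha>" "b11 \<alpha>' * r = p^7 * b11 \<alpha>"
    "Delta \<alpha>' = p^12 * Delta \<alpha>"
proof -
  obtain f where lin: "Vector_Spaces.linear (*s) (*s) f" and "bij f"
    and hom: "\<And>x y. f (L \<alpha> x y) = L \<alpha>' (f x) (f y)"
    using assms(1) unfolding leibniz_isomorphic_def leibniz_iso_def by blast
  define v where "v i = f (e i)" for i
  have f_scale: "f (c *s x) = c *s f x" for c x
    using lin by (simp add: vec.linear_scale)
  have f_uminus: "f (- x) = - f x" and f_diff: "f (x - y) = f x - f y" for x y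
    using lin by (simp_all add: vec.linear_neg vec.linear_diff)
  have bracket: "L \<alpha>' (v i) (v j) = f (basis_bracket \<alpha> i j)" if "i \<le> 8" "j \<le> 8" for i j
    using that by (simp add: v_def hom[symmetric] L_basis)
  have v2: "v 2 = L \<alpha>' (v 1) (v 0)" and v3: "v 3 = L \<alpha>' (v 2) (v 0)"
    and v4: "v 4 = L \<alpha>' (v 3) (v 0)" and v5: "v 5 = L \<alpha>' (v 4) (v 0)"
    and v6: "v 6 = L \<alpha>' (v 5) (v 0)" and v7: "v 7 = L \<alpha>' (v 6) (v 0)"
    and v8: "v 8 = L \<alpha>' (v 7) (v 0)"
    by (simp_all add: bracket) (simp_all add: basis_bracket_def v_def eval_nat_numeral)
  have v61: "L \<alpha>' (v 6) (v 1) = - (b16 \<alpha> *s v 8)" and v00: "L \<alpha>' (v 0) (v 0) = b00 \<alpha> *s v 8"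
    and v01: "L \<alpha>' (v 0) (v 1) = - v 2 + b01 \<alpha> *s v 8" and v11: "L \<alpha>' (v 1) (v 1) = b11 \<alpha> *s v 8"
    by (simp_all add: bracket) (simp_all add: basis_bracket_def v_def f_uminus f_diff f_scale)
  define p q s r where "p = v 0 $ 0" and "q = v 0 $ 1" and "s = v 1 $ 0" and "r = v 1 $ 1"
  \<comment> \<open>The determinant of the map induced by \<open>f\<close> modulo the span of
    \<open>e 2\<close>, ..., \<open>e 8\<close>. For i from 2 to 8 the leading coefficient of
    \<open>v i\<close> is \<open>d * p^(i-2)\<close>.\<close>
  define d where "d = r * p - s * q"
  have v2_nth: "v 2 $ 0 = 0" "v 2 $ 1 = 0" "v 2 $ 2 = d"
    by (simp_all add: v2 L_nth p_def q_def r_def s_def d_def)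
  have v3_nth: "v 3 $ 0 = 0" "v 3 $ 1 = 0" "v 3 $ 2 = 0" "v 3 $ 3 = d * p"
    by (simp_all add: v3 L_nth v2_nth p_def)
  have v4_nth: "v 4 $ 0 = 0" "v 4 $ 1 = 0" "v 4 $ 2 = 0" "v 4 $ 3 = 0" "v 4 $ 4 = d * p^2"
    by (simp_all add: v4 L_nth v3_nth p_def power2_eq_square)
  have v5_nth: "v 5 $ 0 = 0" "v 5 $ 1 = 0" "v 5 $ 2 = 0" "v 5 $ 3 = 0" "v 5 $ 4 = 0"
    "v 5 $ 5 = d * p^3"
    by (simp_all add: v5 L_nth v4_nth p_def power_numeral_reduce)
  have v6_nth: "v 6 $ 0 = 0" "v 6 $ 1 = 0" "v 6 $ 2 = 0" "v 6 $ 3 = 0" "v 6 $ 4 = 0"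
    "v 6 $ 5 = 0" "v 6 $ 6 = d * p^4"
    by (simp_all add: v6 L_nth v5_nth p_def power_numeral_reduce)
  have v7_nth: "v 7 $ 0 = 0" "v 7 $ 1 = 0" "v 7 $ 2 = 0" "v 7 $ 3 = 0" "v 7 $ 4 = 0"
    "v 7 $ 5 = 0" "v 7 $ 6 = 0" "v 7 $ 7 = d * p^5"
    by (simp_all add: v7 L_nth v6_nth p_def power_numeral_reduce)
  have v8_nth: "v 8 $ 0 = 0" "v 8 $ 1 = 0" "v 8 $ 2 = 0" "v 8 $ 3 = 0" "v 8 $ 4 = 0"
    "v 8 $ 5 = 0" "v 8 $ 6 = 0" "v 8 $ 7 = 0" "v 8 $ 8 = d * p^6"
    by (simp_all add: v8 L_nth v7_nth p_def power_numeral_reduce)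
  have "e 8 \<noteq> 0"
    by (simp add: e_def)
  moreover have "f 0 = 0"
    using f_scale[of 0 0] by simp
  ultimately have "v 8 \<noteq> 0"
    using \<open>bij f\<close> by (metis bij_is_inj injD v_def)
  then have "v 8 $ 8 \<noteq> 0"
    using vec9_eqI[of "v 8" 0] by (auto simp: v8_nth)
  then have d: "d \<noteq> 0" and p: "p \<noteq> 0"
    by (auto simp: v8_nth)
  \<comment> \<open>\<open>v 8\<close> is a multiple of \<open>e 8\<close>, so coordinate 7 of
    \<open>v61\<close> vanishes on the right.\<close>
  have "v 6 $ 6 * v 1 $ 0 = 0"
    using arg_cong[OF v61, of "\<lambda>x. x $ 7"] by (simp add: L_nth v6_nth v8_nth)
  then have s: "s = 0"
    using d p by (simp add: v6_nth s_def)
  then have d_eq: "d = r * p"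
    by (simp add: d_def)
  then have r: "r \<noteq> 0"
    using d by auto
  have "b16 \<alpha>' * (v 6 $ 6) * r = b16 \<alpha> * (v 8 $ 8)"
    using arg_cong[OF v61, of "\<lambda>x. x $ 8"] s
    by (simp add: L_nth v6_nth s_def r_def mult.assoc)
  then have "(r * p^5) * (b16 \<alpha>' * r) = (r * p^5) * (p^2 * b16 \<alpha>)"
    unfolding v6_nth v8_nth d_eq by algebra
  then have eq16: "b16 \<alpha>' * r = p^2 * b16 \<alpha>"
    using p r by simp
  have "b11 \<alpha>' * r * r = b11 \<alpha> * (v 8 $ 8)"
    using arg_cong[OF v11, of "\<lambda>x. x $ 8"] s
    by (simp add: L_nth s_def r_def mult.assoc)
  then have "r * (b11 \<alpha>' * r) = r * (p^7 * b11 \<alpha>)"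
    unfolding v8_nth d_eq by algebra
  then have eq11: "b11 \<alpha>' * r = p^7 * b11 \<alpha>"
    using r by simp
  have "b00 \<alpha>' * p^2 + b01 \<alpha>' * p * q + b11 \<alpha>' * q^2 = b00 \<alpha> * (v 8 $ 8)"
    using arg_cong[OF v00, of "\<lambda>x. x $ 8"]
    by (simp add: L_nth p_def q_def power2_eq_square mult.assoc)
  then have "b00 \<alpha>' * p^2 + b01 \<alpha>' * p * q + b11 \<alpha>' * q^2 = b00 \<alpha> * (r * p^7)"
    unfolding v8_nth d_eq by algebra
  moreover have "b01 \<alpha>' * p + 2 * b11 \<alpha>' * q = b01 \<alpha> * p^7"
  proof -
    \<comment> \<open>Symmetrizing cancels \<open>v 2\<close> and leaves the polarization of the
      form x -> [x, x].\<close>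
    have "L \<alpha>' (v 0) (v 1) $ 8 + L \<alpha>' (v 1) (v 0) $ 8 = b01 \<alpha> * (v 8 $ 8)"
      by (simp add: v01 v2[symmetric] del: One_nat_def)
    moreover have "L \<alpha>' (v 0) (v 1) $ 8 + L \<alpha>' (v 1) (v 0) $ 8
        = r * (b01 \<alpha>' * p + 2 * b11 \<alpha>' * q)"
      using s unfolding s_def p_def q_def r_def by (simp add: L_nth algebra_simps)
    ultimately have "r * (b01 \<alpha>' * p + 2 * b11 \<alpha>' * q) = r * (b01 \<alpha> * p^7)"
      unfolding v8_nth d_eq by algebra
    then show ?thesis
      using r by simp
  qed
  \<comment> \<open>Complete the square: the left side is
    \<open>(b01 \<alpha>' * p + 2 * b11 \<alpha>' * q)^2\<close> minus
    \<open>4 * b11 \<alpha>'\<close> times the value of the form at \<open>(p, q)\<close>.\<close>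
  ultimately have "p^2 * Delta \<alpha>' = p^2 * (p^12 * Delta \<alpha>)"
    using eq11 unfolding Delta_def by algebra
  then have "Delta \<alpha>' = p^12 * Delta \<alpha>"
    using power_not_zero[OF p] mult_left_cancel by blast
  then show thesis
    using that p r eq16 eq11 by blast
qed

section \<open>Building an isomorphism from scaling data\<close>

lemma scaling_imp_isomorphic:
  assumes p: "p \<noteq> 0" and r: "r \<noteq> 0" and nz: "b16 \<alpha>' \<noteq> 0" "b11 \<alpha>' \<noteq> 0"
    and eq16: "b16 \<alpha>' * r = p^2 * b16 \<alpha>" and eq11: "b11 \<alpha>' * r = p^7 * b11 \<alpha>"
    and eqD: "Delta \<alpha>' = p^12 * Delta \<alpha>"
  shows "L \<alpha> \<simeq> L \<alpha>'"
proof -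
  \<comment> \<open>\<open>q\<close>, \<open>u\<close> and \<open>w\<close> solve the equations
    \<open>c01\<close>, \<open>c14\<close> and \<open>c12\<close> below, in this order; each is
    linear in its new unknown.\<close>
  define q where "q = (p^7 * b01 \<alpha> - p * b01 \<alpha>') / (2 * b11 \<alpha>')"
  define u where "u = (p^4 * b14 \<alpha> - r * b14 \<alpha>') / (2 * b16 \<alpha>')"
  define w where
    "w = (p^6 * r * b12 \<alpha> - r^2 * b12 \<alpha>' - 2 * r * u * b14 \<alpha>' - u^2 * b16 \<alpha>') / (2 * r * b16 \<alpha>')"
  have q: "2 * b11 \<alpha>' * q = p^7 * b01 \<alpha> - p * b01 \<alpha>'"
    using nz by (simp add: q_def)
  have u: "2 * b16 \<alpha>' * u = p^4 * b14 \<alpha> - r * b14 \<alpha>'"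
    using nz by (simp add: u_def)
  have w: "2 * r * b16 \<alpha>' * w
      = p^6 * r * b12 \<alpha> - r^2 * b12 \<alpha>' - 2 * r * u * b14 \<alpha>' - u^2 * b16 \<alpha>'"
    using nz r by (simp add: w_def)
  \<comment> \<open>The factor by which \<open>f\<close> scales \<open>e 8\<close>.\<close>
  define c where "c = p^7 * r"
  have c16: "c * b16 \<alpha> = p^5 * r^2 * b16 \<alpha>'"
    using eq16 unfolding c_def by algebra
  have c11: "c * b11 \<alpha> = r^2 * b11 \<alpha>'"
    using eq11 unfolding c_def by algebra
  have c01: "c * b01 \<alpha> = p * r * b01 \<alpha>' + 2 * r * q * b11 \<alpha>'"
    using q unfolding c_def by algebra
  \<comment> \<open>No coefficient is left to adjust \<open>b00\<close>; the discriminant relation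
    forces its value.\<close>
  have "4 * b11 \<alpha>' * (c * b00 \<alpha>)
      = 4 * b11 \<alpha>' * (p^2 * b00 \<alpha>' + p * q * b01 \<alpha>' + q^2 * b11 \<alpha>')"
    using q eq11 eqD unfolding c_def Delta_def by algebra
  then have c00: "c * b00 \<alpha> = p^2 * b00 \<alpha>' + p * q * b01 \<alpha>' + q^2 * b11 \<alpha>'"
    using nz by simp
  have c14: "c * b14 \<alpha> = p^3 * (r^2 * b14 \<alpha>' + 2 * r * u * b16 \<alpha>')"
    using u unfolding c_def by algebra
  have c12: "c * b12 \<alpha>
      = p * (r^2 * b12 \<alpha>' + 2 * r * u * b14 \<alpha>' + (u^2 + 2 * r * w) * b16 \<alpha>')"
    using w unfolding c_def by algebra

  \<comment> \<open>\<open>f\<close> is forced by \<open>f e\<^sub>0 = p e\<^sub>0 + q e\<^sub>1\<close>, \<open>f e\<^sub>1 = r e\<^sub>1 + u e\<^sub>3 + w e\<^sub>5\<close> and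
    \<open>f e\<^sub>i\<^sub>+\<^sub>1 = [f e\<^sub>i, f e\<^sub>0]\<close>\<close>
  define f :: "complex ^ 9 \<Rightarrow> complex ^ 9" where "f x =
      (p * x $ 0) *s e 0 + (q * x $ 0 + r * x $ 1) *s e 1 + (p * r * x $ 2) *s e 2
    + (u * x $ 1 + p^2 * r * x $ 3) *s e 3
    + (p * u * x $ 2 + p^3 * r * x $ 4) *s e 4
    + (w * x $ 1 + p^2 * u * x $ 3 + p^4 * r * x $ 5) *s e 5
    + (p * w * x $ 2 + p^3 * u * x $ 4 + p^5 * r * x $ 6) *s e 6
    + (p^2 * w * x $ 3 + p^4 * u * x $ 5 + p^6 * r * x $ 7) *s e 7
    + (q * r * b11 \<alpha>' * x $ 2
      - p * q * (r * b12 \<alpha>' + u * b14 \<alpha>' + w * b16 \<alpha>') * x $ 3 + p^3 * w * x $ 4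
      - p^3 * q * (r * b14 \<alpha>' + u * b16 \<alpha>') * x $ 5 + p^5 * u * x $ 6
      - p^5 * q * r * b16 \<alpha>' * x $ 7 + c * x $ 8) *s e 8" for x
  have f_nth: "f x $ 0 = p * x $ 0" "f x $ 1 = q * x $ 0 + r * x $ 1" "f x $ 2 = p * r * x $ 2"
    "f x $ 3 = u * x $ 1 + p^2 * r * x $ 3"
    "f x $ 4 = p * u * x $ 2 + p^3 * r * x $ 4"
    "f x $ 5 = w * x $ 1 + p^2 * u * x $ 3 + p^4 * r * x $ 5"
    "f x $ 6 = p * w * x $ 2 + p^3 * u * x $ 4 + p^5 * r * x $ 6"
    "f x $ 7 = p^2 * w * x $ 3 + p^4 * u * x $ 5 + p^6 * r * x $ 7"
    "f x $ 8 = q * r * b11 \<alpha>' * x $ 2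
      - p * q * (r * b12 \<alpha>' + u * b14 \<alpha>' + w * b16 \<alpha>') * x $ 3 + p^3 * w * x $ 4
      - p^3 * q * (r * b14 \<alpha>' + u * b16 \<alpha>') * x $ 5 + p^5 * u * x $ 6
      - p^5 * q * r * b16 \<alpha>' * x $ 7 + c * x $ 8" for x
    by (simp_all add: f_def e_def axis_def)
  have lin: "Vector_Spaces.linear (*s) (*s) f"
    by unfold_locales (rule vec9_eqI; simp add: f_nth algebra_simps)+
  have hom: "f (L \<alpha> x y) = L \<alpha>' (f x) (f y)" for x y
  proof (rule vec9_eqI)
    show "f (L \<alpha> x y) $ 8 = L \<alpha>' (f x) (f y) $ 8"
    proof -
      \<comment> \<open>Each parameter of \<open>\<alpha>\<close> is grouped with \<open>c\<close>,
        so that \<open>c00\<close> to \<open>c16\<close> can replace it by parameters of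
        \<open>\<alpha>'\<close>.\<close>
      have "f (L \<alpha> x y) $ 8 = q * r * b11 \<alpha>' * L \<alpha> x y $ 2
          - p * q * (r * b12 \<alpha>' + u * b14 \<alpha>' + w * b16 \<alpha>') * L \<alpha> x y $ 3
          + p^3 * w * L \<alpha> x y $ 4
          - p^3 * q * (r * b14 \<alpha>' + u * b16 \<alpha>') * L \<alpha> x y $ 5 + p^5 * u * L \<alpha> x y $ 6
          - p^5 * q * r * b16 \<alpha>' * L \<alpha> x y $ 7
          + c * (x $ 7 * y $ 0 - x $ 0 * y $ 7)
          + (c * b00 \<alpha>) * (x $ 0 * y $ 0) + (c * b01 \<alpha>) * (x $ 0 * y $ 1)
          + (c * b11 \<alpha>) * (x $ 1 * y $ 1) + (c * b12 \<alpha>) * (x $ 1 * y $ 2 - x $ 2 * y $ 1)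
          + (c * b14 \<alpha>) * (x $ 1 * y $ 4 - x $ 4 * y $ 1 - x $ 2 * y $ 3 + x $ 3 * y $ 2)
          + (c * b16 \<alpha>) * (x $ 1 * y $ 6 - x $ 6 * y $ 1 - x $ 2 * y $ 5 + x $ 5 * y $ 2
              + x $ 3 * y $ 4 - x $ 4 * y $ 3)"
        unfolding f_nth(9) L_nth(9)[of \<alpha>] by (simp add: algebra_simps)
      also have "\<dots> = L \<alpha>' (f x) (f y) $ 8"
        unfolding c00 c01 c11 c12 c14 c16
        by (simp add: L_nth f_nth) (simp add: c_def algebra_simps eval_nat_numeral)
      finally show ?thesis .
    qed
  qed (simp_all add: f_nth L_nth, simp_all add: algebra_simps eval_nat_numeral)
  have c: "c \<noteq> 0"
    using p r by (simp add: c_def)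
  have "inj f"
  proof (rule vec.linear_inj_iff_eq_0[OF lin, THEN iffD2], intro allI impI)
    fix x assume "f x = 0"
    then have "f x $ i = 0" for i by simp
    from this[of 0] this[of 1] this[of 2] this[of 3] this[of 4] this[of 5] this[of 6] this[of 7]
      this[of 8]
    show "x = 0" using p r c
      by (intro vec9_eqI; simp add: f_nth)
  qed
  then have "bij f"
    using vec.linear_injective_imp_surjective[OF lin] by (simp add: bij_def)
  then show ?thesis
    using lin hom unfolding leibniz_isomorphic_def leibniz_iso_def by blast
qed

section \<open>Classification by the invariant\<close>

lemma complex_root_exists:
  fixes z :: complex
  assumes "n > 0"
  shows "\<exists>t. t ^ n = z"
proof (cases "z = 0")
  case True
  then show ?thesis
    using assms by (intro exI[of _ 0]) simp
next
  case False
  then have "exp (Ln z / of_nat n) ^ n = z"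
    using assms by (simp flip: exp_of_nat_mult)
  then show ?thesis ..
qed

text \<open>The ratio \<open>b16 / b11\<close> scales by \<open>p^(-5)\<close> and
  \<open>Delta\<close> by \<open>p^12\<close>, so the powers 12 and 5 cancel \<open>p^60\<close>.
  Conversely, 5 and 12 are coprime, so prescribed nonzero values of \<open>p^5\<close> and
  \<open>p^12\<close> with compatible powers determine \<open>p\<close>.\<close>

lemma isomorphic_iff_invariant:
  assumes nz: "b16 \<alpha> \<noteq> 0" "b11 \<alpha> \<noteq> 0" "b16 \<alpha>' \<noteq> 0" "b11 \<alpha>' \<noteq> 0"
  shows "L \<alpha> \<simeq> L \<alpha>' \<longleftrightarrow>
    (b16 \<alpha> / b11 \<alpha>) ^ 12 * Delta \<alpha> ^ 5 = (b16 \<alpha>' / b11 \<alpha>') ^ 12 * Delta \<alpha>' ^ 5"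
    (is "_ \<longleftrightarrow> ?k ^ 12 * _ = ?k' ^ 12 * _")
proof
  assume "L \<alpha> \<simeq> L \<alpha>'"
  then obtain p r where p: "p \<noteq> 0" and r: "r \<noteq> 0"
    and eqs: "b16 \<alpha>' * r = p^2 * b16 \<alpha>" "b11 \<alpha>' * r = p^7 * b11 \<alpha>"
    and D: "Delta \<alpha>' = p^12 * Delta \<alpha>"
    using isomorphic_imp_scaling nz(1) by blast
  have "?k' = (b16 \<alpha>' * r) / (b11 \<alpha>' * r)"
    using r by simp
  also have "\<dots> = (p^2 * b16 \<alpha>) / (p^2 * (p^5 * b11 \<alpha>))"
    unfolding eqs by (simp add: mult.assoc[symmetric] power_add[symmetric])
  finally have k: "?k = p^5 * ?k'"
    using p by simp
  then show "?k ^ 12 * Delta \<alpha> ^ 5 = ?k' ^ 12 * Delta \<alpha>' ^ 5"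
    unfolding k D by (simp only: power_mult_distrib power_mult[symmetric]) simp
next
  assume inv: "?k ^ 12 * Delta \<alpha> ^ 5 = ?k' ^ 12 * Delta \<alpha>' ^ 5"
  \<comment> \<open>The value that \<open>p^5\<close> must take.\<close>
  define h where "h = ?k / ?k'"
  have h: "h \<noteq> 0" and k: "?k = h * ?k'" and k': "?k' \<noteq> 0"
    using nz by (simp_all add: h_def)
  have h12: "h ^ 12 * Delta \<alpha> ^ 5 = Delta \<alpha>' ^ 5"
  proof -
    have "?k' ^ 12 * (h ^ 12 * Delta \<alpha> ^ 5) = ?k' ^ 12 * Delta \<alpha>' ^ 5"
      using inv unfolding k power_mult_distrib by (simp only: ac_simps)
    then show ?thesis
      using power_not_zero[OF k'] mult_left_cancel by blast
  qed
  have "\<exists>p. p^5 = h \<and> p^12 * Delta \<alpha> = Delta \<alpha>'"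
  proof (cases "Delta \<alpha> = 0")
    \<comment> \<open>Here \<open>h12\<close> forces \<open>Delta \<alpha>' = 0\<close>, so any
      fifth root of \<open>h\<close> serves.\<close>
    case True
    then show ?thesis
      using h12 complex_root_exists[of 5 h] by auto
  next
    case False
    define g where "g = Delta \<alpha>' / Delta \<alpha>"
    have D': "Delta \<alpha>' = g * Delta \<alpha>"
      using False by (simp add: g_def)
    have g5: "g^5 = h^12"
      using h12 False unfolding D' by (simp add: power_mult_distrib)
    have g: "g \<noteq> 0"
      using g5 h by auto
    \<comment> \<open>\<open>p = p\<^sup>2\<^sup>5 / p\<^sup>2\<^sup>4\<close>, where \<open>p\<^sup>5 = h\<close> and \<open>p\<^sup>1\<^sup>2 = g\<close>\<close>
    define p where "p = h^5 / g^2"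
    have "p^5 = h^25 / (g^5)^2"
      by (simp add: p_def power_divide power_mult[symmetric])
    also have "\<dots> = h^24 * h / h^24"
      by (simp add: g5 power_mult[symmetric] flip: power_Suc2)
    finally have p5: "p^5 = h"
      using h by simp
    have "p^12 = (h^12)^5 / g^24"
      by (simp add: p_def power_divide power_mult[symmetric])
    also have "\<dots> = g^24 * g / g^24"
      by (simp add: g5[symmetric] power_mult[symmetric] flip: power_Suc2)
    finally show ?thesis
      using p5 g D' by auto
  qed
  then obtain p where p5: "p^5 = h" and p12: "p^12 * Delta \<alpha> = Delta \<alpha>'"
    by blast
  have p: "p \<noteq> 0"
    using p5 h by auto
  define r where "r = p^2 * b16 \<alpha> / b16 \<alpha>'"
  have r: "r \<noteq> 0" and r16: "b16 \<alpha>' * r = p^2 * b16 \<alpha>"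
    using nz p by (simp_all add: r_def)
  have "b16 \<alpha> * b11 \<alpha>' = h * (b16 \<alpha>' * b11 \<alpha>)"
    using k nz by (simp add: field_simps)
  then have "b16 \<alpha>' * (b11 \<alpha>' * r) = b16 \<alpha>' * (p^7 * b11 \<alpha>)"
    using r16 p5 by algebra
  then show "L \<alpha> \<simeq> L \<alpha>'"
    using scaling_imp_isomorphic[OF p r nz(3,4) r16] nz p12 by simp
qed

text \<open>The invariant of this family is \<open>(-4 * l)^5\<close>, so a fifth root of
  \<open>z\<close> gives \<open>l\<close>.\<close>

lemma invariant_surjective:
  obtains l where "(b16 (Params l 0 1 0 0 1) / b11 (Params l 0 1 0 0 1)) ^ 12
    * Delta (Params l 0 1 0 0 1) ^ 5 = z"
proof -
  obtain t where "t ^ 5 = z"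
    using complex_root_exists[of 5 z] by auto
  then show thesis
    using that[of "- t / 4"] by (simp add: Delta_def)
qed

theorem proposition3p16:
  shows "(\<forall>\<alpha> \<alpha>'. L \<alpha> \<in> U1 \<and> L \<alpha>' \<in> U1 \<longrightarrow>
            (L \<alpha> \<simeq> L \<alpha>' \<longleftrightarrow>
               (b16 \<alpha> / b11 \<alpha>) ^ 12 * Delta \<alpha> ^ 5 = (b16 \<alpha>' / b11 \<alpha>') ^ 12 * Delta \<alpha>' ^ 5)) \<and>
         (\<forall>l::complex. \<exists>\<alpha>. L \<alpha> \<in> U1 \<and> (b16 \<alpha> / b11 \<alpha>) ^ 12 * Delta \<alpha> ^ 5 = l) \<and>
         (\<forall>A\<in>U1. \<exists>l::complex. A \<simeq> L (Params l 0 1 0 0 1))"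
proof (intro conjI allI impI ballI)
  fix \<alpha> \<alpha>' assume "L \<alpha> \<in> U1 \<and> L \<alpha>' \<in> U1"
  then show "L \<alpha> \<simeq> L \<alpha>' \<longleftrightarrow>
      (b16 \<alpha> / b11 \<alpha>) ^ 12 * Delta \<alpha> ^ 5 = (b16 \<alpha>' / b11 \<alpha>') ^ 12 * Delta \<alpha>' ^ 5"
    by (simp add: L_in_U1_iff isomorphic_iff_invariant)
next
  fix l :: complex
  have "L (Params m 0 1 0 0 1) \<in> U1" for m
    by (simp add: L_in_U1_iff)
  then show "\<exists>\<alpha>. L \<alpha> \<in> U1 \<and> (b16 \<alpha> / b11 \<alpha>) ^ 12 * Delta \<alpha> ^ 5 = l"
    using invariant_surjective[of l] by metis
next
  fix A assume "A \<in> U1"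
  then obtain \<alpha> where A: "A = L \<alpha>" and nz: "b16 \<alpha> \<noteq> 0" "b11 \<alpha> \<noteq> 0"
    by (auto simp: U1_def)
  obtain l where "(b16 (Params l 0 1 0 0 1) / b11 (Params l 0 1 0 0 1)) ^ 12
      * Delta (Params l 0 1 0 0 1) ^ 5 = (b16 \<alpha> / b11 \<alpha>) ^ 12 * Delta \<alpha> ^ 5"
    using invariant_surjective by blast
  then have "A \<simeq> L (Params l 0 1 0 0 1)"
    unfolding A using nz by (subst isomorphic_iff_invariant) simp_all
  then show "\<exists>l. A \<simeq> L (Params l 0 1 0 0 1)" ..
qed

end
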